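(* Let $a,u,v,q$ be complex parameters (generic, so that no denominator vanishes). Let $K_0(n):=K(a,q^{-n},q^{1-n},q^{2-n},a,u,v,q^3)$ and $K_0'(n):=K(aq,q^{-n},q^{1-n},q^{2-n},aq,u,v,q^3)$, and put \[ A_r:=\frac{(aq,q^3u,q^3v,aq^4/u,aq^4/v;q^3)_r}{(u,v,aq/u,aq/v,q^3;q^3)_r}. \] (i) The sequences with $\alpha_0=\beta_0=1$, $\alpha_{3r+1}=\alpha_{3r+2}=0$ ($r\ge0$), \[ \alpha_{3r}=\frac{1-aq^{6r}}{1-a}\,\frac{(a,q^3u,q^3v,aq^3/u,aq^3/v;q^3)_r}{(u,v,a/u,a/v,q^3;q^3)_r}\,q^{\frac{9r^2-15r}{2}}(-a)^r,\qquad \beta_n=K_0(n)\frac{(a;q^3)_n}{(a;q)_{2n}(q;q)_n}, \] form a Bailey pair relative to $a$. (ii) The sequences with $\alpha_0=\beta_0=1$, $\alpha_{3r-1}=0$ ($r\ge1$), and for $r\ge0$ \[ \alpha_{3r}=A_r\,q^{\frac{9r^2-13r}{2}}(-a)^r,\quad \alpha_{3r+1}=A_r\,q^{\frac{9r^2-r}{2}+1}(-a)^{r+1},\quad \beta_n=K_0'(n)\frac{(aq;q^3)_n}{(aq;q)_{2n}(q;q)_n}, \] form a Bailey pair relative to $a$. (iii) The sequences with $\alpha_0=\beta_0=1$, $\alpha_{3r-1}=0$ ($r\ge1$), and for $r\ge0$ \[ \alpha_{3r}=A_r\,q^{\frac{9r^2-7r}{2}}(-a)^r,\quad \alpha_{3r+1}=-A_r\,q^{\frac{9r^2-7r}{2}}(-a)^{r},\quad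 \beta_n=K_0'(n)\frac{(aq;q^3)_n\,q^n}{(aq;q)_{2n}(q;q)_n}, \] form a Bailey pair relative to $a$.
   Context: Notation: $(x;q)_n=\prod_{k=0}^{n-1}(1-xq^k)$ and $(x_1,\dots,x_k;q)_n=(x_1;q)_n\cdots(x_k;q)_n$. A pair of sequences $(\alpha_n)_{n\ge0},(\beta_n)_{n\ge0}$ is a Bailey pair relative to $a$ if $\alpha_0=1$ and $\beta_n=\sum_{j=0}^{n}\frac{\alpha_j}{(q;q)_{n-j}(aq;q)_{n+j}}$ for all $n\ge0$. The function $K$: for complex $a,b,c,d,e,u,v$ and a base $p$, let $\sigma_1,\dots,\sigma_4$ be the elementary symmetric functions of $b,c,d,e$ and \[ K(a,b,c,d,e,u,v,p):=\frac{uv(\sigma_3-a\sigma_1)(p\sigma_3-a\sigma_1)a^2+(1-p)uv(a^2-\sigma_4)(a^2-\sigma_2a+\sigma_4)a+(u+v)(a+uv)(\sigma_3-a\sigma_1)(a^2-p\sigma_4)a+(u^2+a)(v^2+a)(a^2-\sigma_4)(a^2-p\sigma_4)}{(a^2-bcde)(a^2-bcde\,p)(1-u)(a-u)(1-v)(a-v)}. \] *)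

theory Defs
  imports Complex_Main
begin

definition qpoch :: "complex \<Rightarrow> complex \<Rightarrow> nat \<Rightarrow> complex" where
  "qpoch x q n = (\<Prod>k<n. 1 - x * q ^ k)"

definition qpochs :: "complex list \<Rightarrow> complex \<Rightarrow> nat \<Rightarrow> complex" where
  "qpochs xs q n = (\<Prod>x\<leftarrow>xs. qpoch x q n)"

definition bailey_pair ::
  "complex \<Rightarrow> complex \<Rightarrow> (nat \<Rightarrow> complex) \<Rightarrow> (nat \<Rightarrow> complex) \<Rightarrow> bool" where
  "bailey_pair a q \<alpha> \<beta> \<longleftrightarrow>
     \<alpha> 0 = 1 \<and>
     (\<forall>n. \<beta> n = (\<Sum>j\<le>n. \<alpha> j / (qpoch q q (n - j) * qpoch (a * q) q (n + j))))"

definition K_num ::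
  "complex \<Rightarrow> complex \<Rightarrow> complex \<Rightarrow> complex \<Rightarrow> complex \<Rightarrow> complex \<Rightarrow> complex \<Rightarrow> complex \<Rightarrow> complex" where
  "K_num a b c d e u v p =
     (let s1 = b + c + d + e;
          s2 = b * c + b * d + b * e + c * d + c * e + d * e;
          s3 = b * c * d + b * c * e + b * d * e + c * d * e;
          s4 = b * c * d * e
      in u * v * (s3 - a * s1) * (p * s3 - a * s1) * a\<^sup>2
         + (1 - p) * u * v * (a\<^sup>2 - s4) * (a\<^sup>2 - s2 * a + s4) * a
         + (u + v) * (a + u * v) * (s3 - a * s1) * (a\<^sup>2 - p * s4) * a
         + (u\<^sup>2 + a) * (v\<^sup>2 + a) * (a\<^sup>2 - s4) * (a\<^sup>2 - p * s4))"

definition K_den ::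
  "complex \<Rightarrow> complex \<Rightarrow> complex \<Rightarrow> complex \<Rightarrow> complex \<Rightarrow> complex \<Rightarrow> complex \<Rightarrow> complex \<Rightarrow> complex" where
  "K_den a b c d e u v p =
     (a\<^sup>2 - b * c * d * e) * (a\<^sup>2 - b * c * d * e * p) * (1 - u) * (a - u) * (1 - v) * (a - v)"

definition K_fun ::
  "complex \<Rightarrow> complex \<Rightarrow> complex \<Rightarrow> complex \<Rightarrow> complex \<Rightarrow> complex \<Rightarrow> complex \<Rightarrow> complex \<Rightarrow> complex" where
  "K_fun a b c d e u v p = K_num a b c d e u v p / K_den a b c d e u v p"

definition K0 :: "complex \<Rightarrow> complex \<Rightarrow> complex \<Rightarrow> complex \<Rightarrow> nat \<Rightarrow> complex" where
  "K0 a u v q n =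
     K_fun a (q powi (- int n)) (q powi (1 - int n)) (q powi (2 - int n)) a u v (q ^ 3)"

definition K0' :: "complex \<Rightarrow> complex \<Rightarrow> complex \<Rightarrow> complex \<Rightarrow> nat \<Rightarrow> complex" where
  "K0' a u v q n =
     K_fun (a * q) (q powi (- int n)) (q powi (1 - int n)) (q powi (2 - int n)) (a * q) u v (q ^ 3)"

definition A_coeff :: "complex \<Rightarrow> complex \<Rightarrow> complex \<Rightarrow> complex \<Rightarrow> nat \<Rightarrow> complex" where
  "A_coeff a u v q r =
     qpochs [a * q, q ^ 3 * u, q ^ 3 * v, a * q ^ 4 / u, a * q ^ 4 / v] (q ^ 3) r /
     qpochs [u, v, a * q / u, a * q / v, q ^ 3] (q ^ 3) r"

(* Every integer division by 2 in the exponents below is exact. *)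

definition alpha1 :: "complex \<Rightarrow> complex \<Rightarrow> complex \<Rightarrow> complex \<Rightarrow> nat \<Rightarrow> complex" where
  "alpha1 a u v q n =
     (let r = n div 3 in
      if n mod 3 = 0 then
        (1 - a * q ^ (6 * r)) / (1 - a) *
        (qpochs [a, q ^ 3 * u, q ^ 3 * v, a * q ^ 3 / u, a * q ^ 3 / v] (q ^ 3) r /
         qpochs [u, v, a / u, a / v, q ^ 3] (q ^ 3) r) *
        q powi ((9 * (int r)\<^sup>2 - 15 * int r) div 2) * (- a) ^ r
      else 0)"

definition beta1 :: "complex \<Rightarrow> complex \<Rightarrow> complex \<Rightarrow> complex \<Rightarrow> nat \<Rightarrow> complex" where
  "beta1 a u v q n = K0 a u v q n * (qpoch a (q ^ 3) n / (qpoch a q (2 * n) * qpoch q q n))"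

definition alpha2 :: "complex \<Rightarrow> complex \<Rightarrow> complex \<Rightarrow> complex \<Rightarrow> nat \<Rightarrow> complex" where
  "alpha2 a u v q n =
     (let r = n div 3 in
      if n mod 3 = 0 then
        A_coeff a u v q r * q powi ((9 * (int r)\<^sup>2 - 13 * int r) div 2) * (- a) ^ r
      else if n mod 3 = 1 then
        A_coeff a u v q r * q powi ((9 * (int r)\<^sup>2 - int r) div 2 + 1) * (- a) ^ (r + 1)
      else 0)"

definition beta2 :: "complex \<Rightarrow> complex \<Rightarrow> complex \<Rightarrow> complex \<Rightarrow> nat \<Rightarrow> complex" where
  "beta2 a u v q n =
     K0' a u v q n * (qpoch (a * q) (q ^ 3) n / (qpoch (a * q) q (2 * n) * qpoch q q n))"

definition alpha3 :: "complex \<Rightarrow> complex \<Rightarrow> complex \<Rightarrow> complex \<Rightarrow> nat \<Rightarrow> complex" where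
  "alpha3 a u v q n =
     (let r = n div 3 in
      if n mod 3 = 0 then
        A_coeff a u v q r * q powi ((9 * (int r)\<^sup>2 - 7 * int r) div 2) * (- a) ^ r
      else if n mod 3 = 1 then
        - A_coeff a u v q r * q powi ((9 * (int r)\<^sup>2 - 7 * int r) div 2) * (- a) ^ r
      else 0)"

definition beta3 :: "complex \<Rightarrow> complex \<Rightarrow> complex \<Rightarrow> complex \<Rightarrow> nat \<Rightarrow> complex" where
  "beta3 a u v q n =
     K0' a u v q n *
     (qpoch (a * q) (q ^ 3) n * q ^ n / (qpoch (a * q) q (2 * n) * qpoch q q n))"

(* Genericity: the denominators occurring in the sequences and in the Bailey relation do not
   vanish.  The non-vanishing of q, u and v accounts for the negative powers of q and for the
   quotients by u and v; for a, it is implied by K_den not vanishing. *)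

definition generic_common :: "complex \<Rightarrow> complex \<Rightarrow> complex \<Rightarrow> complex \<Rightarrow> bool" where
  "generic_common a u v q \<longleftrightarrow>
     q \<noteq> 0 \<and> u \<noteq> 0 \<and> v \<noteq> 0 \<and>
     (\<forall>n. qpoch q q n \<noteq> 0) \<and> (\<forall>n. qpoch (a * q) q n \<noteq> 0)"

definition generic1 :: "complex \<Rightarrow> complex \<Rightarrow> complex \<Rightarrow> complex \<Rightarrow> bool" where
  "generic1 a u v q \<longleftrightarrow>
     generic_common a u v q \<and>
     1 - a \<noteq> 0 \<and>
     (\<forall>r. qpochs [u, v, a / u, a / v, q ^ 3] (q ^ 3) r \<noteq> 0) \<and>
     (\<forall>n. qpoch a q (2 * n) \<noteq> 0) \<and>
     (\<forall>n. K_den a (q powi (- int n)) (q powi (1 - int n)) (q powi (2 - int n)) a u v (q ^ 3) \<noteq> 0)"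

definition generic2 :: "complex \<Rightarrow> complex \<Rightarrow> complex \<Rightarrow> complex \<Rightarrow> bool" where
  "generic2 a u v q \<longleftrightarrow>
     generic_common a u v q \<and>
     (\<forall>r. qpochs [u, v, a * q / u, a * q / v, q ^ 3] (q ^ 3) r \<noteq> 0) \<and>
     (\<forall>n. K_den (a * q) (q powi (- int n)) (q powi (1 - int n)) (q powi (2 - int n)) (a * q)
            u v (q ^ 3) \<noteq> 0)"

end

theory Submission
  imports Defs
begin

text \<open>
  Put \<open>N = q^n\<close>, \<open>Q = q^(3r)\<close> and \<open>z = 1/Q + a Q\<close>. The factors of \<open>\<alpha>\<close> that contain \<open>u\<close> combine
  to \<open>(1 - u Q) (1 - a Q / u) = Q (z - (u + a/u))\<close>, and likewise for \<open>v\<close>. Hence the Bailey sum is a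
  combination of the moments of orders 0, 1, 2 of \<open>z\<close> with respect to the weights of the
  terminating very-well-poised 6-phi-5 series in base \<open>q^3\<close>, which do not involve \<open>u\<close> and \<open>v\<close>.
  The identity \<open>(1 - N/Q) (1 - a N Q) = 1 + a N^2 - N z\<close> shows that multiplying the weight by this
  linear function of \<open>z\<close> lowers \<open>n\<close> by one, so these moments are expressed through the 6-phi-5 sums
  for \<open>n\<close>, \<open>n - 1\<close>, \<open>n - 2\<close>. The sums satisfy a first-order recurrence in \<open>n\<close> that is obtained by
  telescoping in \<open>r\<close>. In parts (ii) and (iii) the terms with indices \<open>3r\<close> and \<open>3r + 1\<close> add up to
  the \<open>r\<close>-th term of part (i) with \<open>a q\<close> in place of \<open>a\<close>.
\<close>

section \<open>Products, kernel, weights and moments\<close>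

lemma qpoch_0 [simp]: "qpoch x q 0 = 1"
  by (simp add: qpoch_def)

lemma qpoch_Suc: "qpoch x q (Suc n) = qpoch x q n * (1 - x * q ^ n)"
  by (simp add: qpoch_def)

lemma qpoch_Suc_shift: "qpoch x q (Suc n) = (1 - x) * qpoch (x * q) q n"
  unfolding qpoch_def by (subst prod.lessThan_Suc_shift) (simp add: mult.assoc)

lemma qpoch_base_shift: "(1 - x) * qpoch (p * x) p n = qpoch x p n * (1 - x * p ^ n)"
  by (metis qpoch_Suc qpoch_Suc_shift mult.commute)

text \<open>
  The index \<open>n\<close> is an integer and the kernel vanishes for \<open>n < 3r\<close>, so that the recurrences
  below hold without boundary cases. The factor \<open>1 - a\<close> of the very-well-poised part is absorbed
  into \<open>(a;q)\<close> with index \<open>n + 3r + 1\<close>.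
\<close>

definition bailey_ker :: "complex \<Rightarrow> complex \<Rightarrow> int \<Rightarrow> nat \<Rightarrow> complex" where
  "bailey_ker a q n r =
     (if 3 * int r \<le> n
      then 1 / (qpoch q q (nat (n - 3 * int r)) * qpoch a q (nat (n + 3 * int r + 1)))
      else 0)"

text \<open>The part of \<alpha> at index \<open>3r\<close> that is free of \<open>u\<close> and
  \<open>v\<close>, without the very-well-poised factor. Its exponent of \<open>q\<close> exceeds
  that of part (i) by \<open>6r\<close>, because the factors with \<open>u\<close> and
  \<open>v\<close> contribute \<open>Q^2\<close> when written in terms of \<open>z\<close>.\<close>

definition cubic_weight :: "complex \<Rightarrow> complex \<Rightarrow> nat \<Rightarrow> complex" where
  "cubic_weight a q r =
     qpoch a (q ^ 3) r / qpoch (q ^ 3) (q ^ 3) r * q powi ((9 * (int r)\<^sup>2 - 3 * int r) div 2) * (- a) ^ r"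

definition node :: "complex \<Rightarrow> complex \<Rightarrow> nat \<Rightarrow> complex" where
  "node a q r = 1 / q ^ (3 * r) + a * q ^ (3 * r)"

text \<open>The range \<open>m\<close> is kept apart from the index \<open>n\<close>, so that
  moments at \<open>n\<close>, \<open>n - 1\<close> and \<open>n - 2\<close> are sums over the same
  range and can be combined term by term.\<close>

definition cubic_moment :: "complex \<Rightarrow> complex \<Rightarrow> nat \<Rightarrow> nat \<Rightarrow> int \<Rightarrow> complex" where
  "cubic_moment a q m k n =
     (\<Sum>r\<le>m. (1 - a * q ^ (6 * r)) * cubic_weight a q r * bailey_ker a q n r * node a q r ^ k)"

section \<open>Rational identities behind the recurrence and the function \<open>K\<close>\<close>

text \<open>The certificate of the telescoping, with \<open>N = q^n\<close> and
  \<open>Q = q^(3r)\<close>: after division by the common weight and kernel, the left side is the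
  summand of the recurrence and the right side the difference of consecutive values of the
  antidifference.\<close>

lemma telescoping_identity:
  fixes a q N Q :: complex
  assumes "q \<noteq> 0" "Q \<noteq> 0"
  shows "(1 - a * Q\<^sup>2) * ((1 - a * N ^ 3 / q ^ 3) * (1 + a * N\<^sup>2 - N * (1 / Q + a * Q))
            - (1 - N) * (1 - a * N\<^sup>2 / q) * (1 - a * N\<^sup>2 / q\<^sup>2))
       = N * (- a * Q\<^sup>2 * (1 - a * Q) * ((1 - N / Q) * (1 - N / Q / q) * (1 - N / Q / q\<^sup>2))
            - (1 - Q) * ((1 - a * N * Q) * (1 - a * N * Q / q) * (1 - a * N * Q / q\<^sup>2)) / Q)"
proof -
  \<comment> \<open>The reciprocals become variables subject to polynomial relations, which puts the
    claim within reach of \<open>algebra\<close>.\<close>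
  define i j where "i = 1 / Q" and "j = 1 / q"
  have *: "i * Q = 1" "j * q = 1" using assms by (simp_all add: i_def j_def)
  have div: "x / Q = x * i" "x / q = x * j" "x / q\<^sup>2 = x * j^2" "x / q ^ 3 = x * j ^ 3" for x
    by (simp_all add: i_def j_def power_divide)
  show ?thesis unfolding div using * by algebra
qed

text \<open>The hypothesis is the recurrence in which the zeroth moment at \<open>n - 1\<close> has
  been expressed through \<open>B\<close> and \<open>M1\<close>, the moments at \<open>n\<close> of
  orders 0 and 1. Solving it for \<open>M1\<close> produces the factors of \<open>K\<close> for
  \<open>b, c, d = q^(-n), q^(1-n), q^(2-n)\<close> and \<open>e = a\<close>.\<close>

lemma moment_identity_1:
  fixes a q N :: complex
  assumes nz: "q \<noteq> 0" "N \<noteq> 0"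
    and M: "(1 - a * N ^ 3 / q ^ 3) * ((1 + a * N\<^sup>2) * B - N * M1)
              = (1 - N) * (1 - a * N\<^sup>2 / q) * (1 - a * N\<^sup>2 / q\<^sup>2) * B"
    and b: "b = 1 / N" and c: "c = q / N" and d: "d = q\<^sup>2 / N"
  shows "a * ((b * c * d + b * c * a + b * d * a + c * d * a) - a * (b + c + d + a)) * B
           = - M1 * (a\<^sup>2 - b * c * d * a)"
proof -
  have bN: "b * N = 1" using nz b by simp
  have cd: "c = q * b" "d = q\<^sup>2 * b" using b c d by simp_all
  define j where "j = 1 / q"
  have j: "j * q = 1" using nz by (simp add: j_def)
  have div: "x / q = x * j" "x / q\<^sup>2 = x * j^2" "x / q ^ 3 = x * j ^ 3" for x
    by (simp_all add: j_def power_divide)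
  show ?thesis using M unfolding div cd using bN j by algebra
qed

text \<open>Here \<open>M\<close> stands for \<open>q^(n-2)\<close>; \<open>P1, D1\<close> and
  \<open>P2, D2\<close> are the coefficients of the recurrence at \<open>n\<close> and
  \<open>n - 1\<close>. The left side is the \<open>u v\<close> coefficient in the numerator of
  \<open>K\<close>, free of \<open>u + v\<close>, with its denominators cleared.\<close>

lemma moment_polynomial_identity:
  fixes a q M :: complex
  defines "N \<equiv> q\<^sup>2 * M"
  defines "P1 \<equiv> (1 - N) * (1 - a * q ^ 3 * M\<^sup>2) * (1 - a * q\<^sup>2 * M\<^sup>2)"
  defines "P2 \<equiv> (1 - q * M) * (1 - a * q * M\<^sup>2) * (1 - a * M\<^sup>2)"
  defines "D1 \<equiv> 1 - a * q ^ 3 * M ^ 3"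
  defines "D2 \<equiv> 1 - a * M ^ 3"
  shows "N\<^sup>2 * ((q ^ 3 + a * N * (q + q\<^sup>2 + q ^ 3) - a * N\<^sup>2 * (1 + q + q\<^sup>2) - a\<^sup>2 * N ^ 3)
            * (q ^ 3 * (q ^ 3 + a * N * (q + q\<^sup>2 + q ^ 3)) - a * N\<^sup>2 * (1 + q + q\<^sup>2) - a\<^sup>2 * N ^ 3) * a\<^sup>2
          + (1 - q ^ 3) * (a\<^sup>2 * N ^ 3 - q ^ 3 * a)
            * (a\<^sup>2 * N ^ 3 - a * (N * (q + q\<^sup>2 + q ^ 3) + a * N\<^sup>2 * (1 + q + q\<^sup>2)) + q ^ 3 * a) * a)
        = a\<^sup>2 * q ^ 9 * (q * (P2 * P1 - (1 + a * N\<^sup>2) * (1 + a * q\<^sup>2 * M\<^sup>2) * D1 * D2)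
            + (q * (1 + a * q\<^sup>2 * M\<^sup>2) + (1 + a * N\<^sup>2)) * D2 * (D1 * (1 + a * N\<^sup>2) - P1))"
  unfolding assms by algebra

text \<open>Two applications of the recurrence determine \<open>M2\<close> once \<open>M1\<close> is
  eliminated. The second hypothesis is the recurrence iterated once, with the zeroth moment at
  \<open>n - 2\<close> written through the moments at \<open>n\<close>.\<close>

lemma moment_identity_2:
  fixes a q N :: complex
  assumes nz: "q \<noteq> 0" "N \<noteq> 0"
    and M1: "(1 - a * N ^ 3 / q ^ 3) * ((1 + a * N\<^sup>2) * B - N * M1)
              = (1 - N) * (1 - a * N\<^sup>2 / q) * (1 - a * N\<^sup>2 / q\<^sup>2) * B"
    and M2: "(1 - a * N ^ 3 / q ^ 6) * (1 - a * N ^ 3 / q ^ 3) *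
               ((1 + a * N\<^sup>2) * (1 + a * N\<^sup>2 / q\<^sup>2) * B
                - (N * (1 + a * N\<^sup>2 / q\<^sup>2) + N / q * (1 + a * N\<^sup>2)) * M1 + N\<^sup>2 / q * M2)
              = (1 - N / q) * (1 - a * N\<^sup>2 / q ^ 3) * (1 - a * N\<^sup>2 / q ^ 4) *
                ((1 - N) * (1 - a * N\<^sup>2 / q) * (1 - a * N\<^sup>2 / q\<^sup>2)) * B"
    and b: "b = 1 / N" and c: "c = q / N" and d: "d = q\<^sup>2 / N" and p: "p = q ^ 3"
    and s1: "s1 = b + c + d + a"
    and s2: "s2 = b * c + b * d + b * a + c * d + c * a + d * a"
    and s3: "s3 = b * c * d + b * c * a + b * d * a + c * d * a"
    and s4: "s4 = b * c * d * a"
  shows "((s3 - a * s1) * (p * s3 - a * s1) * a\<^sup>2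
          + (1 - p) * (a\<^sup>2 - s4) * (a\<^sup>2 - s2 * a + s4) * a) * B
         = M2 * (a\<^sup>2 - s4) * (a\<^sup>2 - p * s4)"
proof -
  \<comment> \<open>in terms of \<open>M\<close> no negative powers of \<open>q\<close> remain\<close>
  define M where "M = N / q\<^sup>2"
  have N: "N = q\<^sup>2 * M" using nz by (simp add: M_def)
  have e: "a * N ^ 3 / q ^ 3 = a * q ^ 3 * M ^ 3" "a * N ^ 3 / q ^ 6 = a * M ^ 3"
    "a * N\<^sup>2 / q = a * q ^ 3 * M\<^sup>2" "a * N\<^sup>2 / q\<^sup>2 = a * q\<^sup>2 * M\<^sup>2"
    "a * N\<^sup>2 / q ^ 3 = a * q * M\<^sup>2" "a * N\<^sup>2 / q ^ 4 = a * M\<^sup>2"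
    "N / q = q * M" "N\<^sup>2 / q = q ^ 3 * M\<^sup>2"
    using nz by (simp_all add: N field_simps power_mult_distrib eval_nat_numeral)
  define P1 where "P1 = (1 - N) * (1 - a * q ^ 3 * M\<^sup>2) * (1 - a * q\<^sup>2 * M\<^sup>2)"
  define P2 where "P2 = (1 - q * M) * (1 - a * q * M\<^sup>2) * (1 - a * M\<^sup>2)"
  define D1 where "D1 = 1 - a * q ^ 3 * M ^ 3"
  define D2 where "D2 = 1 - a * M ^ 3"
  define X where "X = 1 + a * N\<^sup>2"
  define Y where "Y = 1 + a * q\<^sup>2 * M\<^sup>2"
  define L where "L = (s3 - a * s1) * (p * s3 - a * s1) * a\<^sup>2
          + (1 - p) * (a\<^sup>2 - s4) * (a\<^sup>2 - s2 * a + s4) * a"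
  define Z where "Z = q * (P2 * P1 - X * Y * D1 * D2) + (q * Y + X) * D2 * (D1 * X - P1)"
  have A: "D1 * (X * B - N * M1) = P1 * B"
    using M1 unfolding e P1_def D1_def X_def .
  have "D2 * D1 * (X * Y * B - (N * Y + q * M * X) * M1 + q ^ 3 * M\<^sup>2 * M2) = P2 * P1 * B"
    using M2 unfolding e P1_def P2_def D1_def D2_def X_def Y_def by simp
  \<comment> \<open>The factor \<open>q\<close> turns \<open>q * M\<close> and
    \<open>q ^ 3 * M\<^sup>2\<close> into \<open>N\<close> and \<open>N\<^sup>2\<close>.\<close>
  then have "q * (D2 * D1 * (X * Y * B - (N * Y + q * M * X) * M1 + q ^ 3 * M\<^sup>2 * M2)) = q * (P2 * P1 * B)"
    by simp
  then have "D2 * D1 * (q * X * Y * B - (q * Y + X) * (N * M1) + N\<^sup>2 * M2) = q * (P2 * P1 * B)"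
    unfolding N by algebra
  \<comment> \<open>By \<open>A\<close>, \<open>D1 * N * M1\<close> equals
    \<open>(D1 * X - P1) * B\<close>, which removes the first moment.\<close>
  with A have C: "D1 * D2 * N\<^sup>2 * M2 = Z * B"
    unfolding Z_def by algebra
  have bN: "b * N = 1" using nz b by simp
  have cd: "c = q * b" "d = q\<^sup>2 * b" using b c d by simp_all
  have t3: "N ^ 3 * s3 = q ^ 3 + a * N * (q + q\<^sup>2 + q ^ 3)"
    unfolding s3 cd using bN by algebra
  have t1: "N ^ 3 * (a * s1) = a * N\<^sup>2 * (1 + q + q\<^sup>2) + a\<^sup>2 * N ^ 3"
    unfolding s1 cd using bN by algebra
  have t2: "N ^ 3 * (s2 * a) = a * (N * (q + q\<^sup>2 + q ^ 3) + a * N\<^sup>2 * (1 + q + q\<^sup>2))"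
    unfolding s2 cd using bN by algebra
  have t4: "N ^ 3 * s4 = q ^ 3 * a"
    unfolding s4 cd using bN by algebra
  have "N ^ 6 * L = (N ^ 3 * s3 - N ^ 3 * (a * s1)) * (p * (N ^ 3 * s3) - N ^ 3 * (a * s1)) * a\<^sup>2
          + (1 - p) * (a\<^sup>2 * N ^ 3 - N ^ 3 * s4) * (a\<^sup>2 * N ^ 3 - N ^ 3 * (s2 * a) + N ^ 3 * s4) * a"
    unfolding L_def by algebra
  also have "N\<^sup>2 * \<dots> = a\<^sup>2 * q ^ 9 * Z"
    using moment_polynomial_identity[of q M a]
    unfolding t1 t2 t3 t4 p Z_def X_def Y_def P1_def P2_def D1_def D2_def unfolding N
    by (simp only: diff_diff_eq)
  finally have L: "N\<^sup>2 * (N ^ 6 * L) = a\<^sup>2 * q ^ 9 * Z" .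
  \<comment> \<open>Up to monomials, the first two factors of the denominator of \<open>K\<close>
    are the coefficients \<open>D1\<close> and \<open>D2\<close> of the recurrence.\<close>
  have F1: "N ^ 3 * (a\<^sup>2 - s4) = - a * q ^ 3 * D1"
    using t4 unfolding D1_def N by algebra
  have F2: "N ^ 3 * (a\<^sup>2 - p * s4) = - a * q ^ 6 * D2"
    using t4 unfolding D2_def N p by algebra
  have "N ^ 8 * (L * B) = N\<^sup>2 * (N ^ 6 * L) * B" by algebra
  also have "\<dots> = a\<^sup>2 * q ^ 9 * (D1 * D2 * N\<^sup>2 * M2)" unfolding L C by simp
  also have "\<dots> = N\<^sup>2 * M2 * (- a * q ^ 3 * D1) * (- a * q ^ 6 * D2)" by algebra
  also have "\<dots> = N ^ 8 * (M2 * (a\<^sup>2 - s4) * (a\<^sup>2 - p * s4))"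
    unfolding F1[symmetric] F2[symmetric] by algebra
  finally show ?thesis using nz unfolding L_def by simp
qed


section \<open>Recurrences of kernel and weight\<close>

text \<open>The parameter \<open>a\<close> of the locale is the given \<open>a\<close> in part (i)
  and \<open>a q\<close> in parts (ii) and (iii).\<close>

locale cubic_bailey =
  fixes a q :: complex
  assumes q_nz: "q \<noteq> 0"
    and qpoch_q_nz: "qpoch q q n \<noteq> 0"
    and qpoch_a_nz: "qpoch a q n \<noteq> 0"
begin

abbreviation "ker \<equiv> bailey_ker a q"
abbreviation "wt \<equiv> cubic_weight a q"
abbreviation "z \<equiv> node a q"
abbreviation "mom \<equiv> cubic_moment a q"

lemma ker_eq_0: "n < 3 * int r \<Longrightarrow> ker n r = 0"
  by (simp add: bailey_ker_def)

lemma ker_nat: "ker (int (k + 3 * r)) r = 1 / (qpoch q q k * qpoch a q (k + 6 * r + 1))"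
proof -
  have "nat (int (k + 3 * r) - 3 * int r) = k" "nat (int (k + 3 * r) + 3 * int r + 1) = k + 6 * r + 1"
    by simp_all
  then show ?thesis by (simp add: bailey_ker_def)
qed

lemma one_minus_q_power_nz: "1 - q ^ Suc k \<noteq> 0"
  using qpoch_q_nz[of "Suc k"] by (simp add: qpoch_Suc)

lemma one_minus_a_q_power_nz: "1 - a * q ^ k \<noteq> 0"
  using qpoch_a_nz[of "Suc k"] by (simp add: qpoch_Suc)

lemma qpoch_q_cube_nz: "qpoch (q ^ 3) (q ^ 3) r \<noteq> 0"
proof -
  have "1 - q ^ 3 * (q ^ 3) ^ k \<noteq> 0" for k
  proof -
    have "q ^ 3 * (q ^ 3) ^ k = q ^ (3 * Suc k)" by (simp only: power_mult power_Suc)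
    also have "3 * Suc k = Suc (3 * k + 2)" by simp
    finally show ?thesis using one_minus_q_power_nz[of "3 * k + 2"] by (simp only: not_False_eq_True)
  qed
  then show ?thesis by (simp add: qpoch_def)
qed

text \<open>The two factors are \<open>1 - q^(n - 3r)\<close> and \<open>1 - a q^(n + 3r)\<close>,
  the last factors of the two products in the kernel.\<close>

lemma ker_lower:
  "ker n r * ((1 - q powi n / q ^ (3 * r)) * (1 - a * q powi n * q ^ (3 * r))) = ker (n - 1) r"
proof (cases "3 * int r < n")
  case True
  define k where "k = nat (n - 3 * int r - 1)"
  have n: "n = int (Suc k + 3 * r)" and n1: "n - 1 = int (k + 3 * r)"
    using True by (simp_all add: k_def)
  have powi: "q powi n = q ^ (Suc k + 3 * r)" unfolding n by (rule power_int_of_nat)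
  have e1: "q powi n / q ^ (3 * r) = q * q ^ k"
    unfolding powi power_add using q_nz by simp
  have "Suc k + 3 * r + 3 * r = Suc (k + 6 * r)" by simp
  then have e2: "a * q powi n * q ^ (3 * r) = a * q ^ Suc (k + 6 * r)"
    unfolding powi mult.assoc power_add[symmetric] by (simp only:)
  have k1: "ker n r = 1 / (qpoch q q (Suc k) * qpoch a q (Suc (Suc (k + 6 * r))))"
    unfolding n ker_nat by simp
  have k2: "ker (n - 1) r = 1 / (qpoch q q k * qpoch a q (Suc (k + 6 * r)))"
    unfolding n1 ker_nat by simp
  show ?thesis unfolding e1 e2 k1 k2
    using qpoch_q_nz[of "Suc k"] qpoch_a_nz[of "Suc (Suc (k + 6 * r))"]
    unfolding qpoch_Suc[of _ _ k] qpoch_Suc[of _ _ "Suc (k + 6 * r)"] by simp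
next
  case False
  show ?thesis
  \<comment> \<open>At \<open>n = 3r\<close> the factor \<open>1 - N / Q\<close> is zero, in
    agreement with the zero kernel at \<open>n - 1\<close>.\<close>
  proof (cases "n = 3 * int r")
    case True
    then have "q powi n = q ^ (3 * r)"
      by (metis of_nat_mult of_nat_numeral power_int_of_nat)
    then show ?thesis using True q_nz by (simp add: bailey_ker_def)
  qed (use False in \<open>simp add: bailey_ker_def\<close>)
qed

text \<open>Passing from \<open>r\<close> to \<open>r + 1\<close> removes three factors from the
  product in \<open>q\<close> and adds three to the product in \<open>a\<close>. If
  \<open>n - 3r\<close> is 0, 1 or 2, the kernel at \<open>r + 1\<close> is zero and so is one
  factor on the right.\<close>

lemma ker_Suc:
  fixes n :: int and r :: nat
  defines "N \<equiv> q powi n" and "Q \<equiv> q ^ (3 * r)"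
  shows "ker n (Suc r) * ((1 - a * N * (Q * q ^ 3)) * (1 - a * N * (Q * q ^ 3) / q) * (1 - a * N * (Q * q ^ 3) / q\<^sup>2))
       = ker n r * ((1 - N / Q) * (1 - N / Q / q) * (1 - N / Q / q\<^sup>2))"
proof (cases "3 * int r \<le> n")
  case True
  define k where "k = nat (n - 3 * int r)"
  have n: "n = int (k + 3 * r)" using True by (simp add: k_def)
  have N: "N = q ^ k * Q" unfolding N_def Q_def n power_int_of_nat power_add ..
  have Q_nz: "Q \<noteq> 0" using q_nz by (simp add: Q_def)
  have NQ: "N / Q = q ^ k" unfolding N using Q_nz by simp
  consider "k = 0" | "k = 1" | "k = 2" | l where "k = l + 3"
    by (metis One_nat_def Suc_1 add.commute add_2_eq_Suc' not0_implies_Suc numeral_3_eq_3 add_Suc_right add_0_right)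
  then show ?thesis
  proof cases
    case (4 l)
    have n': "n = int (l + 3 * Suc r)" unfolding n 4 by simp
    have "q ^ (k + 6 * r) = q ^ k * Q\<^sup>2"
      by (simp add: Q_def power_add power_mult[symmetric] mult.commute)
    then have Qs: "a * N * (Q * q ^ 3) = a * q ^ Suc (Suc (Suc (k + 6 * r)))"
      "a * N * (Q * q ^ 3) / q = a * q ^ Suc (Suc (k + 6 * r))"
      "a * N * (Q * q ^ 3) / q\<^sup>2 = a * q ^ Suc (k + 6 * r)"
      using q_nz by (simp_all add: N power2_eq_square power3_eq_cube)
    have "l + 6 * Suc r + 1 = Suc (Suc (Suc (Suc (k + 6 * r))))" unfolding 4 by simp
    then have k1: "ker n (Suc r) = 1 / (qpoch q q l * qpoch a q (Suc (Suc (Suc (Suc (k + 6 * r))))))"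
      unfolding n' ker_nat by (simp only:)
    have k2: "ker n r = 1 / (qpoch q q (Suc (Suc (Suc l))) * qpoch a q (Suc (k + 6 * r)))"
      unfolding n ker_nat unfolding 4 by (simp add: numeral_3_eq_3)
    have qs: "q ^ k / q = q ^ Suc (Suc l)" "q ^ k / q\<^sup>2 = q ^ Suc l" "q ^ k = q ^ Suc (Suc (Suc l))"
      using q_nz by (simp_all add: 4 power_add power2_eq_square power3_eq_cube)
    have nz: "1 - q ^ Suc l \<noteq> 0" "1 - q ^ Suc (Suc l) \<noteq> 0" "1 - q ^ Suc (Suc (Suc l)) \<noteq> 0"
      "1 - a * q ^ Suc (k + 6 * r) \<noteq> 0" "1 - a * q ^ Suc (Suc (k + 6 * r)) \<noteq> 0"
      "1 - a * q ^ Suc (Suc (Suc (k + 6 * r))) \<noteq> 0"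
      by (rule one_minus_q_power_nz one_minus_a_q_power_nz)+
    have cancel: "1 / (x * (y * A1 * A2 * A3)) * (A3 * A2 * A1) = 1 / (x * B1 * B2 * B3 * y) * (B3 * B2 * B1)"
      if "A1 \<noteq> 0" "A2 \<noteq> 0" "A3 \<noteq> 0" "B1 \<noteq> 0" "B2 \<noteq> 0" "B3 \<noteq> 0" for x y A1 A2 A3 B1 B2 B3 :: complex
      using that by (simp add: divide_simps)
    show ?thesis
      unfolding NQ Qs(2,3) k1 k2 qs(1,2)
      unfolding Qs(1) qs(3)
      unfolding qpoch_Suc[of q q l] qpoch_Suc[of q q "Suc l"] qpoch_Suc[of q q "Suc (Suc l)"]
        qpoch_Suc[of a q "Suc (k + 6 * r)"] qpoch_Suc[of a q "Suc (Suc (k + 6 * r))"]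
        qpoch_Suc[of a q "Suc (Suc (Suc (k + 6 * r)))"] power_Suc[symmetric]
      by (rule cancel) (rule nz)+
  qed (use q_nz n in \<open>simp_all add: NQ ker_eq_0\<close>)
qed (simp add: ker_eq_0)

lemma weight_Suc:
  "wt (Suc r) * (1 - q ^ (3 * r) * q ^ 3) = wt r * (1 - a * q ^ (3 * r)) * (- a * (q ^ (3 * r)) ^ 3 * q ^ 3)"
proof -
  \<comment> \<open>With the increment written as a multiple of 2, it leaves \<open>div 2\<close>
    without a parity argument.\<close>
  have "(9 * (int (Suc r))\<^sup>2 - 3 * int (Suc r)) = (9 * (int r)\<^sup>2 - 3 * int r) + int (9 * r + 3) * 2"
    by (simp add: power2_eq_square algebra_simps)
  then have "(9 * (int (Suc r))\<^sup>2 - 3 * int (Suc r)) div 2 = (9 * (int r)\<^sup>2 - 3 * int r) div 2 + int (9 * r + 3)"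
    by (metis div_mult_self1 add.commute zero_neq_numeral)
  then have e: "q powi ((9 * (int (Suc r))\<^sup>2 - 3 * int (Suc r)) div 2)
      = q powi ((9 * (int r)\<^sup>2 - 3 * int r) div 2) * ((q ^ (3 * r)) ^ 3 * q ^ 3)"
    using q_nz by (simp only: power_int_add power_int_of_nat power_add power_mult[symmetric] simp_thms)
      (simp add: mult.commute mult.left_commute)
  have "1 - q ^ 3 * (q ^ 3) ^ r \<noteq> 0" using qpoch_q_cube_nz[of "Suc r"] by (simp add: qpoch_Suc)
  moreover have "q ^ (3 * r) = (q ^ 3) ^ r" by (rule power_mult)
  ultimately show ?thesis unfolding cubic_weight_def e qpoch_Suc
    by (simp add: mult_ac)
qed


section \<open>Summation of the zeroth moment\<close>

text \<open>The factors of \<open>G\<close> are those that \<open>weight_Suc\<close> and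
  \<open>ker_Suc\<close> require at \<open>r + 1\<close>. Both terms on the right thus become
  multiples of \<open>wt r * ker n r\<close>, and \<open>telescoping_identity\<close>
  remains.\<close>

lemma weight_kernel_telescopes:
  fixes n :: int
  defines "N \<equiv> q powi n"
  defines "G \<equiv> \<lambda>r. N * wt r * ker n r * (1 - q ^ (3 * r)) *
     ((1 - a * N * q ^ (3 * r)) * (1 - a * N * q ^ (3 * r) / q) * (1 - a * N * q ^ (3 * r) / q\<^sup>2)) / q ^ (3 * r)"
  shows "(1 - a * q ^ (6 * r)) * wt r * ker n r *
      ((1 - a * N ^ 3 / q ^ 3) * (1 + a * N\<^sup>2 - N * z r)
        - (1 - N) * (1 - a * N\<^sup>2 / q) * (1 - a * N\<^sup>2 / q\<^sup>2)) = G (Suc r) - G r"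
proof -
  define Q where "Q = q ^ (3 * r)"
  have Q_nz: "Q \<noteq> 0" using q_nz by (simp add: Q_def)
  have Q2: "q ^ (6 * r) = Q\<^sup>2" by (simp add: Q_def power_mult[symmetric] mult.commute)
  have QS: "q ^ (3 * Suc r) = Q * q ^ 3" by (simp add: Q_def power_add)
  have zr: "z r = 1 / Q + a * Q" by (simp add: node_def Q_def)
  let ?A = "(1 - a * N * (Q * q ^ 3)) * (1 - a * N * (Q * q ^ 3) / q) * (1 - a * N * (Q * q ^ 3) / q\<^sup>2)"
  let ?B = "(1 - N / Q) * (1 - N / Q / q) * (1 - N / Q / q\<^sup>2)"
  let ?C = "(1 - a * N * Q) * (1 - a * N * Q / q) * (1 - a * N * Q / q\<^sup>2)"
  have "G (Suc r) = N * (wt (Suc r) * (1 - Q * q ^ 3)) * (ker n (Suc r) * ?A) / (Q * q ^ 3)"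
    unfolding G_def QS by (simp only: mult_ac)
  also have "\<dots> = N * (wt r * (1 - a * Q) * (- a * Q ^ 3 * q ^ 3)) * (ker n r * ?B) / (Q * q ^ 3)"
    using weight_Suc[of r] ker_Suc[of n r] unfolding Q_def N_def by simp
  also have "\<dots> = wt r * ker n r * (N * (- a * Q\<^sup>2 * (1 - a * Q) * ?B))"
    using Q_nz q_nz by (simp add: power2_eq_square power3_eq_cube)
  finally have GS: "G (Suc r) = wt r * ker n r * (N * (- a * Q\<^sup>2 * (1 - a * Q) * ?B))" .
  have G: "G r = wt r * ker n r * (N * ((1 - Q) * ?C / Q))"
    unfolding G_def Q_def[symmetric] by simp
  have "G (Suc r) - G r = wt r * ker n r * (N * (- a * Q\<^sup>2 * (1 - a * Q) * ?B - (1 - Q) * ?C / Q))"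
    unfolding GS G by (simp only: right_diff_distrib)
  also have "\<dots> = wt r * ker n r * ((1 - a * Q\<^sup>2) * ((1 - a * N ^ 3 / q ^ 3) * (1 + a * N\<^sup>2 - N * (1 / Q + a * Q))
            - (1 - N) * (1 - a * N\<^sup>2 / q) * (1 - a * N\<^sup>2 / q\<^sup>2)))"
    unfolding telescoping_identity[OF q_nz Q_nz] ..
  finally show ?thesis unfolding Q2 zr by (simp only: mult_ac)
qed

lemma mom_lower:
  "(1 + a * (q powi n)\<^sup>2) * mom m k n - q powi n * mom m (Suc k) n = mom m k (n - 1)"
proof -
  define N where "N = q powi n"
  have "(1 + a * N\<^sup>2 - N * z r) * ker n r = ker (n - 1) r" for r
  proof -
    have "1 + a * N\<^sup>2 - N * z r = (1 - N / q ^ (3 * r)) * (1 - a * N * q ^ (3 * r))"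
      using q_nz by (simp add: node_def field_simps power2_eq_square)
    then show ?thesis using ker_lower[of n r] unfolding N_def by (simp add: mult.commute)
  qed
  then have "mom m k (n - 1) = (\<Sum>r\<le>m. (1 - a * q ^ (6 * r)) * wt r * ((1 + a * N\<^sup>2 - N * z r) * ker n r) * z r ^ k)"
    unfolding cubic_moment_def by simp
  also have "\<dots> = (1 + a * N\<^sup>2) * mom m k n - N * mom m (Suc k) n"
    unfolding cubic_moment_def sum_distrib_left sum_subtractf[symmetric]
    by (rule sum.cong) (simp_all add: algebra_simps)
  finally show ?thesis unfolding N_def ..
qed

lemma mom_0_recurrence:
  fixes n :: int
  assumes "n \<le> int m"
  defines "N \<equiv> q powi n"
  shows "(1 - a * N ^ 3 / q ^ 3) * mom m 0 (n - 1)
       = (1 - N) * (1 - a * N\<^sup>2 / q) * (1 - a * N\<^sup>2 / q\<^sup>2) * mom m 0 n"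
proof -
  define D where "D = 1 - a * N ^ 3 / q ^ 3"
  define P where "P = (1 - N) * (1 - a * N\<^sup>2 / q) * (1 - a * N\<^sup>2 / q\<^sup>2)"
  define G where "G r = N * wt r * ker n r * (1 - q ^ (3 * r)) *
     ((1 - a * N * q ^ (3 * r)) * (1 - a * N * q ^ (3 * r) / q) * (1 - a * N * q ^ (3 * r) / q\<^sup>2)) / q ^ (3 * r)" for r
  have "D * mom m 0 (n - 1) - P * mom m 0 n = D * ((1 + a * N\<^sup>2) * mom m 0 n - N * mom m (Suc 0) n) - P * mom m 0 n"
    using mom_lower[of n m 0] unfolding N_def by simp
  also have "\<dots> = (\<Sum>r\<le>m. (1 - a * q ^ (6 * r)) * wt r * ker n r * (D * (1 + a * N\<^sup>2 - N * z r) - P))"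
    unfolding cubic_moment_def sum_distrib_left sum_subtractf[symmetric]
    by (rule sum.cong) (simp_all add: algebra_simps)
  also have "\<dots> = (\<Sum>r\<le>m. G (Suc r) - G r)"
    using weight_kernel_telescopes[of _ n] unfolding G_def D_def P_def N_def by simp
  also have "\<dots> = G (Suc m) - G 0"
    unfolding lessThan_Suc_atMost[symmetric] by (rule sum_lessThan_telescope)
  \<comment> \<open>\<open>G 0\<close> contains \<open>1 - q^0\<close>, and \<open>n \<le> m\<close>
    makes the kernel at \<open>r = m + 1\<close> zero.\<close>
  also have "\<dots> = 0"
    using assms by (simp add: G_def ker_eq_0)
  finally show ?thesis unfolding D_def P_def by simp
qed

text \<open>The terminating 6-phi-5 sum: the recurrence yields the quotient of consecutive values,
  and at \<open>n = 0\<close> only the term \<open>r = 0\<close> survives.\<close>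

lemma mom_0_eq:
  "n \<le> m \<Longrightarrow> mom m 0 (int n) = qpoch a (q ^ 3) n / (qpoch a q (2 * n) * qpoch q q n)"
proof (induction n)
  case 0
  have "mom m 0 0 = (\<Sum>r\<in>{0}. (1 - a * q ^ (6 * r)) * wt r * ker 0 r * z r ^ 0)"
    unfolding cubic_moment_def by (rule sum.mono_neutral_right) (auto simp: ker_eq_0)
  also have "\<dots> = 1"
    using one_minus_a_q_power_nz[of 0] by (simp add: cubic_weight_def bailey_ker_def qpoch_def)
  finally show ?case by simp
next
  case (Suc n)
  have N: "q powi int (Suc n) = q ^ Suc n" by (rule power_int_of_nat)
  have e: "a * (q ^ Suc n) ^ 3 / q ^ 3 = a * (q ^ 3) ^ n"
    "a * (q ^ Suc n)\<^sup>2 / q = a * q ^ Suc (2 * n)" "a * (q ^ Suc n)\<^sup>2 / q\<^sup>2 = a * q ^ (2 * n)"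
    using q_nz by (simp_all add: power_mult_distrib power_mult[symmetric] mult.commute, simp add: power2_eq_square)
  have "(1 - a * (q ^ 3) ^ n) * mom m 0 (int n)
      = (1 - q ^ Suc n) * (1 - a * q ^ Suc (2 * n)) * (1 - a * q ^ (2 * n)) * mom m 0 (int (Suc n))"
    using mom_0_recurrence[of "int (Suc n)" m] Suc.prems unfolding N e by simp
  moreover have "mom m 0 (int n) = qpoch a (q ^ 3) n / (qpoch a q (2 * n) * qpoch q q n)"
    using Suc by simp
  moreover have "2 * Suc n = Suc (Suc (2 * n))" by simp
  ultimately show ?case
    using one_minus_q_power_nz[of n] one_minus_a_q_power_nz[of "Suc (2 * n)"] one_minus_a_q_power_nz[of "2 * n"]
      qpoch_q_nz[of n] qpoch_a_nz[of "2 * n"]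
    by (simp add: qpoch_Suc divide_simps) (simp add: mult_ac)
qed


section \<open>The function \<open>K\<close> as a combination of moments\<close>

text \<open>Divided by \<open>u v\<close>, the numerator of \<open>K\<close> is a polynomial in
  \<open>x + y\<close> and \<open>x y\<close>. Multiplied by the zeroth moment, its coefficients
  become the moments of orders 2, 1, 0 times a common factor, which cancels against the
  denominator.\<close>

lemma K0_times_mom:
  fixes n :: nat
  assumes nz: "u \<noteq> 0" "v \<noteq> 0"
    and den: "K_den a (q powi (- int n)) (q powi (1 - int n)) (q powi (2 - int n)) a u v (q ^ 3) \<noteq> 0"
  defines "x \<equiv> u + a / u" and "y \<equiv> v + a / v"
  shows "K0 a u v q n * mom n 0 (int n) * ((1 - u) * (1 - a / u) * (1 - v) * (1 - a / v))
       = mom n 2 (int n) - (x + y) * mom n 1 (int n) + x * y * mom n 0 (int n)"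
proof -
  define N where "N = q ^ n"
  define b c d p where "b = 1 / N" and "c = q / N" and "d = q\<^sup>2 / N" and "p = q ^ 3"
  define s1 s2 s3 s4 where "s1 = b + c + d + a"
    and "s2 = b * c + b * d + b * a + c * d + c * a + d * a"
    and "s3 = b * c * d + b * c * a + b * d * a + c * d * a"
    and "s4 = b * c * d * a"
  define B M1 M2 where "B = mom n 0 (int n)" and "M1 = mom n 1 (int n)" and "M2 = mom n 2 (int n)"
  define D1 D2 where "D1 = 1 - a * N ^ 3 / q ^ 3" and "D2 = 1 - a * N ^ 3 / q ^ 6"
  define P1 P2 where "P1 = (1 - N) * (1 - a * N\<^sup>2 / q) * (1 - a * N\<^sup>2 / q\<^sup>2)"
    and "P2 = (1 - N / q) * (1 - a * N\<^sup>2 / q ^ 3) * (1 - a * N\<^sup>2 / q ^ 4)"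
  have N_nz: "N \<noteq> 0" using q_nz by (simp add: N_def)
  have powi: "q powi int n = N" "q powi (int n - 1) = N / q"
    using q_nz by (simp_all add: N_def power_int_diff)
  have args: "q powi (- int n) = b" "q powi (1 - int n) = c" "q powi (2 - int n) = d"
    using q_nz by (simp_all add: b_def c_def d_def N_def power_int_diff power_int_minus divide_inverse)
  have L0: "(1 + a * N\<^sup>2) * B - N * M1 = mom n 0 (int n - 1)"
    and L1: "(1 + a * N\<^sup>2) * M1 - N * M2 = mom n 1 (int n - 1)"
    using mom_lower[of "int n" n 0] mom_lower[of "int n" n 1]
    unfolding powi B_def M1_def M2_def by (simp_all add: numeral_2_eq_2)
  have L2: "(1 + a * N\<^sup>2 / q\<^sup>2) * mom n 0 (int n - 1) - N / q * mom n 1 (int n - 1) = mom n 0 (int n - 1 - 1)"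
    using mom_lower[of "int n - 1" n 0] unfolding powi by (simp add: power_divide)
  have R1: "D1 * mom n 0 (int n - 1) = P1 * B"
    using mom_0_recurrence[of "int n" n] unfolding powi D1_def P1_def B_def by simp
  have R2: "D2 * mom n 0 (int n - 1 - 1) = P2 * mom n 0 (int n - 1)"
    using mom_0_recurrence[of "int n - 1" n] unfolding powi D2_def P2_def
    by (simp add: power_divide mult.commute power_add[symmetric] power_mult[symmetric] flip: power_Suc power_Suc2)
  have H1: "D1 * ((1 + a * N\<^sup>2) * B - N * M1) = P1 * B"
    unfolding L0 by (rule R1)
  \<comment> \<open>Lowering twice, with \<open>N / q\<close> for \<open>N\<close> the second time,
    reaches the zeroth moment at \<open>n - 2\<close>.\<close>
  have "(1 + a * N\<^sup>2) * (1 + a * N\<^sup>2 / q\<^sup>2) * B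
       - (N * (1 + a * N\<^sup>2 / q\<^sup>2) + N / q * (1 + a * N\<^sup>2)) * M1 + N\<^sup>2 / q * M2
     = (1 + a * N\<^sup>2 / q\<^sup>2) * ((1 + a * N\<^sup>2) * B - N * M1) - N / q * ((1 + a * N\<^sup>2) * M1 - N * M2)"
    by (simp add: algebra_simps power2_eq_square)
  also have "\<dots> = mom n 0 (int n - 1 - 1)"
    unfolding L0 L1 L2 ..
  also have "D2 * D1 * \<dots> = P2 * P1 * B"
    using R1 R2 by algebra
  finally have H2: "D2 * D1 * ((1 + a * N\<^sup>2) * (1 + a * N\<^sup>2 / q\<^sup>2) * B
       - (N * (1 + a * N\<^sup>2 / q\<^sup>2) + N / q * (1 + a * N\<^sup>2)) * M1 + N\<^sup>2 / q * M2) = P2 * P1 * B" .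
  have I1: "a * (s3 - a * s1) * B = - M1 * (a\<^sup>2 - s4)"
    using moment_identity_1[OF q_nz N_nz H1[unfolded D1_def P1_def] b_def c_def d_def]
    unfolding s1_def s3_def s4_def .
  have I2: "((s3 - a * s1) * (p * s3 - a * s1) * a\<^sup>2
          + (1 - p) * (a\<^sup>2 - s4) * (a\<^sup>2 - s2 * a + s4) * a) * B = M2 * (a\<^sup>2 - s4) * (a\<^sup>2 - p * s4)"
    by (rule moment_identity_2[OF q_nz N_nz H1[unfolded D1_def P1_def] H2[unfolded D1_def P1_def D2_def P2_def]
          b_def c_def d_def p_def s1_def s2_def s3_def s4_def])
  have regroup: "(u * v * T1 * T2 * a\<^sup>2 + (1 - p) * u * v * F1 * T3 * a + (u * v * (x + y)) * T1 * F2 * a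
        + (u * x) * (v * y) * F1 * F2) * B
      = u * v * ((T1 * T2 * a\<^sup>2 + (1 - p) * F1 * T3 * a) * B + (x + y) * F2 * (a * T1 * B) + x * y * (F1 * F2) * B)"
    for T1 T2 T3 F1 F2 by (simp add: algebra_simps)
  have collect: "u * v * (M2 * F1 * F2 + (x + y) * F2 * (- M1 * F1) + x * y * (F1 * F2) * B)
      = u * v * (F1 * F2) * (M2 - (x + y) * M1 + x * y * B)" for F1 F2 by (simp add: algebra_simps)
  define E where "E = (a\<^sup>2 - s4) * (a\<^sup>2 - p * s4)"
  have ux: "u\<^sup>2 + a = u * x" "v\<^sup>2 + a = v * y" "(u + v) * (a + u * v) = u * v * (x + y)"
    using nz by (simp_all add: x_def y_def field_simps power2_eq_square)
  have "K_num a b c d a u v p =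
      u * v * (s3 - a * s1) * (p * s3 - a * s1) * a\<^sup>2
         + (1 - p) * u * v * (a\<^sup>2 - s4) * (a\<^sup>2 - s2 * a + s4) * a
         + (u * v * (x + y)) * (s3 - a * s1) * (a\<^sup>2 - p * s4) * a
         + (u * x) * (v * y) * (a\<^sup>2 - s4) * (a\<^sup>2 - p * s4)"
    unfolding ux[symmetric] K_num_def Let_def s1_def s2_def s3_def s4_def ..
  also have "\<dots> * B = u * v * (((s3 - a * s1) * (p * s3 - a * s1) * a\<^sup>2
          + (1 - p) * (a\<^sup>2 - s4) * (a\<^sup>2 - s2 * a + s4) * a) * B
          + (x + y) * (a\<^sup>2 - p * s4) * (a * (s3 - a * s1) * B) + x * y * E * B)"
    unfolding E_def by (rule regroup)
  also have "\<dots> = u * v * E * (M2 - (x + y) * M1 + x * y * B)"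
    unfolding I1 I2 E_def by (rule collect)
  finally have num: "K_num a b c d a u v p * B = u * v * E * (M2 - (x + y) * M1 + x * y * B)" .
  have au: "a - u = - u * (1 - a / u)" "a - v = - v * (1 - a / v)"
    using nz by (simp_all add: field_simps)
  have dn: "K_den a b c d a u v p = u * v * E * ((1 - u) * (1 - a / u) * (1 - v) * (1 - a / v))"
    unfolding K_den_def E_def s4_def au by (simp add: mult_ac)
  have "u * v * E \<noteq> 0" "(1 - u) * (1 - a / u) * (1 - v) * (1 - a / v) \<noteq> 0"
    using den unfolding args p_def[symmetric] dn by auto
  then have "K_num a b c d a u v p * B / K_den a b c d a u v p * ((1 - u) * (1 - a / u) * (1 - v) * (1 - a / v))
      = M2 - (x + y) * M1 + x * y * B"
    unfolding num dn by simp
  then show ?thesis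
    unfolding K0_def K_fun_def args p_def[symmetric] B_def M1_def M2_def by (simp only: times_divide_eq_left)
qed

section \<open>Summation of the very-well-poised terms\<close>

definition poised :: "complex \<Rightarrow> complex \<Rightarrow> nat \<Rightarrow> complex" where
  "poised u v r =
     qpochs [a, q ^ 3 * u, q ^ 3 * v, a * q ^ 3 / u, a * q ^ 3 / v] (q ^ 3) r /
     qpochs [u, v, a / u, a / v, q ^ 3] (q ^ 3) r * q powi ((9 * (int r)\<^sup>2 - 15 * int r) div 2) * (- a) ^ r"

text \<open>For \<open>t\<close> among \<open>u\<close>, \<open>v\<close>, \<open>a / u\<close>,
  \<open>a / v\<close> the quotient of shifted products collapses to
  \<open>(1 - t Q) / (1 - t)\<close>. The pairs of numerators give \<open>Q (z - x)\<close> and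
  \<open>Q (z - y)\<close>.\<close>

lemma poised_eq:
  assumes nz: "u \<noteq> 0" "v \<noteq> 0"
    and den: "\<And>r. qpochs [u, v, a / u, a / v, q ^ 3] (q ^ 3) r \<noteq> 0"
  defines "x \<equiv> u + a / u" and "y \<equiv> v + a / v"
  shows "poised u v r * ((1 - u) * (1 - a / u) * (1 - v) * (1 - a / v))
       = wt r * (z r ^ 2 - (x + y) * z r + x * y)"
proof -
  define p Q where "p = q ^ 3" and "Q = q ^ (3 * r)"
  have Q: "Q = p ^ r" "Q \<noteq> 0" using q_nz by (simp_all add: p_def Q_def power_mult)
  \<comment> \<open>The case of index 1 in \<open>den\<close> supplies
    \<open>1 - t \<noteq> 0\<close>.\<close>
  have nz1: "qpoch t p r \<noteq> 0" "1 - t \<noteq> 0" if "t \<in> {u, v, a / u, a / v}" for t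
    using den[of r] den[of 1] that by (auto simp: qpochs_def qpoch_def p_def)
  have ratio: "qpoch (p * t) p r / qpoch t p r * (1 - t) = 1 - t * Q" if "t \<in> {u, v, a / u, a / v}" for t
    using qpoch_base_shift[of t p r] nz1[OF that] unfolding Q by (simp add: field_simps)
  have "(9 * (int r)\<^sup>2 - 3 * int r) = (9 * (int r)\<^sup>2 - 15 * int r) + int (6 * r) * 2" by simp
  then have "(9 * (int r)\<^sup>2 - 3 * int r) div 2 = (9 * (int r)\<^sup>2 - 15 * int r) div 2 + int (6 * r)"
    by (metis div_mult_self1 add.commute zero_neq_numeral)
  then have "q powi ((9 * (int r)\<^sup>2 - 3 * int r) div 2) = q powi ((9 * (int r)\<^sup>2 - 15 * int r) div 2) * q ^ (6 * r)"
    using q_nz by (simp only: power_int_add power_int_of_nat simp_thms)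
  also have "q ^ (6 * r) = Q\<^sup>2" by (simp add: Q_def power_mult[symmetric] mult.commute)
  finally have pw: "q powi ((9 * (int r)\<^sup>2 - 15 * int r) div 2) = q powi ((9 * (int r)\<^sup>2 - 3 * int r) div 2) / Q\<^sup>2"
    using Q by simp
  have sh: "a * p / u = p * (a / u)" "a * p / v = p * (a / v)" by simp_all
  have zr: "z r = 1 / Q + a * Q" by (simp add: node_def Q_def)
  have "poised u v r * ((1 - u) * (1 - a / u) * (1 - v) * (1 - a / v))
     = wt r / Q\<^sup>2 * ((qpoch (p * u) p r / qpoch u p r * (1 - u)) * (qpoch (p * (a / u)) p r / qpoch (a / u) p r * (1 - a / u))
        * (qpoch (p * v) p r / qpoch v p r * (1 - v)) * (qpoch (p * (a / v)) p r / qpoch (a / v) p r * (1 - a / v)))"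
    unfolding poised_def cubic_weight_def pw p_def[symmetric] sh qpochs_def
    by (simp add: mult_ac)
  also have "\<dots> = wt r / Q\<^sup>2 * ((1 - u * Q) * (1 - a / u * Q) * ((1 - v * Q) * (1 - a / v * Q)))"
    by (simp only: ratio insertI1 insertI2 mult.assoc)
  also have "(1 - u * Q) * (1 - a / u * Q) = Q * (z r - x)"
    using nz Q(2) by (simp add: x_def zr field_simps)
  also have "(1 - v * Q) * (1 - a / v * Q) = Q * (z r - y)"
    using nz Q(2) by (simp add: y_def zr field_simps)
  also have "wt r / Q\<^sup>2 * (Q * (z r - x) * (Q * (z r - y))) = wt r * ((z r - x) * (z r - y))"
    using Q(2) by (simp add: power2_eq_square)
  finally show ?thesis by (simp add: algebra_simps power2_eq_square)
qed

lemma poised_sum: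
  assumes nz: "u \<noteq> 0" "v \<noteq> 0"
    and den: "\<And>r. qpochs [u, v, a / u, a / v, q ^ 3] (q ^ 3) r \<noteq> 0"
    and Kden: "K_den a (q powi (- int n)) (q powi (1 - int n)) (q powi (2 - int n)) a u v (q ^ 3) \<noteq> 0"
  shows "(\<Sum>r\<le>n. (1 - a * q ^ (6 * r)) * poised u v r * ker (int n) r)
       = K0 a u v q n * (qpoch a (q ^ 3) n / (qpoch a q (2 * n) * qpoch q q n))"
proof -
  define C where "C = (1 - u) * (1 - a / u) * (1 - v) * (1 - a / v)"
  define x y where "x = u + a / u" and "y = v + a / v"
  have C: "C \<noteq> 0" using den[of 1] by (simp add: C_def qpochs_def qpoch_def)
  have "(\<Sum>r\<le>n. (1 - a * q ^ (6 * r)) * poised u v r * ker (int n) r) * C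
      = (\<Sum>r\<le>n. (1 - a * q ^ (6 * r)) * (poised u v r * C) * ker (int n) r)"
    unfolding sum_distrib_right by (simp only: mult_ac)
  also have "\<dots> = mom n 2 (int n) - (x + y) * mom n 1 (int n) + x * y * mom n 0 (int n)"
    unfolding C_def poised_eq[OF nz den] x_def[symmetric] y_def[symmetric]
    unfolding cubic_moment_def sum_distrib_left sum_subtractf[symmetric] sum.distrib[symmetric]
    by (rule sum.cong) (simp_all add: algebra_simps)
  also have "\<dots> = K0 a u v q n * mom n 0 (int n) * C"
    unfolding C_def x_def y_def K0_times_mom[OF nz Kden] ..
  finally show ?thesis unfolding mom_0_eq[OF order.refl] mult_right_cancel[OF C] .
qed

text \<open>The kernel provides the common denominator of the terms with indices \<open>3r\<close>
  and \<open>3r + 1\<close>. At \<open>n = 3r\<close> the second term is absent, and its coefficient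
  \<open>1 - q^0\<close> vanishes too.\<close>

lemma adjacent_terms:
  "(if 3 * r \<le> n then s / (qpoch q q (n - 3 * r) * qpoch a q (n + 3 * r)) else 0)
   + (if 3 * r + 1 \<le> n then t / (qpoch q q (n - (3 * r + 1)) * qpoch a q (n + (3 * r + 1))) else 0)
   = (s * (1 - a * q ^ (n + 3 * r)) + t * (1 - q ^ (n - 3 * r))) * ker (int n) r"
proof (cases "3 * r \<le> n")
  case True
  then obtain k where n: "n = k + 3 * r" by (metis le_add_diff_inverse2)
  have k6: "k + 3 * r + 3 * r = k + 6 * r" "k + 3 * r + (3 * r + 1) = Suc (k + 6 * r)" by simp_all
  have nz: "qpoch a q (k + 6 * r) \<noteq> 0" "1 - a * q ^ (k + 6 * r) \<noteq> 0"
    by (rule qpoch_a_nz one_minus_a_q_power_nz)+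
  have ker: "ker (int n) r = 1 / (qpoch q q k * (qpoch a q (k + 6 * r) * (1 - a * q ^ (k + 6 * r))))"
    unfolding n ker_nat by (simp add: qpoch_Suc)
  show ?thesis
  proof (cases k)
    case 0
    then show ?thesis using True nz unfolding ker unfolding n k6 by simp
  next
    case (Suc l)
    have "n - (3 * r + 1) = l" "n - 3 * r = Suc l" "3 * r + 1 \<le> n" using n Suc by simp_all
    moreover have "qpoch q q k = qpoch q q l * (1 - q ^ Suc l)" "qpoch q q l \<noteq> 0" "1 - q ^ Suc l \<noteq> 0"
      using qpoch_q_nz one_minus_q_power_nz[of l] by (simp_all add: Suc qpoch_Suc)
    moreover have "s / (x * X * y) + t / (x * (y * Y)) = (s * Y + t * X) * (1 / (x * X * (y * Y)))"
      if "x \<noteq> 0" "y \<noteq> 0" "X \<noteq> 0" "Y \<noteq> 0" for x y X Y :: complex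
      using that by (simp add: divide_simps)
    moreover have "n + 3 * r = k + 6 * r" "n + (3 * r + 1) = Suc (k + 6 * r)" using n by simp_all
    ultimately show ?thesis
      using True nz unfolding ker Suc[symmetric] by (simp only: qpoch_Suc[of a q "Suc l + 6 * r"] if_True simp_thms Suc)
  qed
qed (simp add: ker_eq_0)

end

section \<open>Splitting the Bailey sum modulo 3\<close>

text \<open>Letting \<open>r\<close> run up to \<open>n\<close> matches the range of the moments;
  the guards discard the surplus indices.\<close>

lemma sum_by_residue_3:
  fixes f :: "nat \<Rightarrow> 'a::comm_monoid_add"
  shows "(\<Sum>j\<le>n. f j) = (\<Sum>r\<le>n. \<Sum>i<3. if 3 * r + i \<le> n then f (3 * r + i) else 0)"
proof -
  define g where "g j = (if j \<le> n then f j else 0)" for j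
  have "(\<Sum>j\<le>n. f j) = (\<Sum>j<Suc n * 3. g j)"
    by (rule sum.mono_neutral_cong_left) (auto simp: g_def)
  also have "\<dots> = (\<Sum>r<Suc n. \<Sum>j = r * 3..<r * 3 + 3. g j)"
    by (rule sum.nat_group[symmetric])
  also have "\<dots> = (\<Sum>r\<le>n. \<Sum>i<3. g (3 * r + i))"
    unfolding lessThan_Suc_atMost
    by (simp add: eval_nat_numeral ac_simps)
  finally show ?thesis by (simp add: g_def)
qed


lemma sum_lessThan_3: "(\<Sum>i<3. h i) = h 0 + h 1 + h (2::nat)" for h :: "nat \<Rightarrow> 'a::comm_monoid_add"
  by (simp add: eval_nat_numeral)

lemma div_mod_3:
  "(3 * r) div 3 = r" "(3 * r + 1) div 3 = r" "(3 * r + 2) div 3 = r"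
  "(3 * r) mod 3 = 0" "(3 * r + 1) mod 3 = 1" "(3 * r + 2) mod 3 = 2" for r :: nat
  by presburger+

text \<open>Truncated differences \<open>n - 3 * r\<close> are harmless, since the kernel is zero
  wherever truncation occurs.\<close>

lemma (in cubic_bailey) sum_ker_cong:
  assumes "\<And>r. 3 * r \<le> n \<Longrightarrow> f r = g r"
  shows "(\<Sum>r\<le>m. f r * ker (int n) r) = (\<Sum>r\<le>m. g r * ker (int n) r)"
proof (rule sum.cong)
  show "f r * ker (int n) r = g r * ker (int n) r" for r
    using assms[of r] by (cases "3 * r \<le> n") (simp_all add: ker_eq_0)
qed simp

lemma (in cubic_bailey) adjacent_sum:
  assumes c: "\<And>r. c (3 * r) = s r" "\<And>r. c (3 * r + 1) = t r" "\<And>r. c (3 * r + 2) = 0"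
  shows "(\<Sum>j\<le>n. c j / (qpoch q q (n - j) * qpoch a q (n + j)))
   = (\<Sum>r\<le>n. (s r * (1 - a * q ^ (n + 3 * r)) + t r * (1 - q ^ (n - 3 * r))) * ker (int n) r)"
  unfolding adjacent_terms[symmetric]
  by (subst sum_by_residue_3) (simp only: sum_lessThan_3 c add_0_right div_0 if_cancel)

text \<open>The Bailey relation at \<open>n = 0\<close> gives the initial value of \<beta>, so
  \<open>K\<close> need not be evaluated there.\<close>

lemma bailey_pairI:
  assumes "\<alpha> 0 = 1"
    and "\<And>n. (\<Sum>j\<le>n. \<alpha> j / (qpoch q q (n - j) * qpoch (a * q) q (n + j))) = \<beta> n"
  shows "\<beta> 0 = 1 \<and> bailey_pair a q \<alpha> \<beta>"
  using assms assms(2)[of 0] by (simp add: bailey_pair_def)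

section \<open>The three Bailey pairs\<close>

lemma bailey_pair_1:
  assumes "generic1 a u v q"
  shows "beta1 a u v q 0 = 1 \<and> bailey_pair a q (alpha1 a u v q) (beta1 a u v q)"
proof (rule bailey_pairI)
  have a1: "1 - a \<noteq> 0" and nz: "q \<noteq> 0" "u \<noteq> 0" "v \<noteq> 0"
    and qq: "\<And>n. qpoch q q n \<noteq> 0" and aq: "\<And>n. qpoch (a * q) q n \<noteq> 0"
    and den: "\<And>r. qpochs [u, v, a / u, a / v, q ^ 3] (q ^ 3) r \<noteq> 0"
    and Kden: "\<And>n. K_den a (q powi (- int n)) (q powi (1 - int n)) (q powi (2 - int n)) a u v (q ^ 3) \<noteq> 0"
    using assms by (auto simp: generic1_def generic_common_def)
  interpret cubic_bailey a q
  proof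
    show "qpoch a q n \<noteq> 0" for n
      using a1 aq by (cases n) (simp_all add: qpoch_Suc_shift)
  qed (use nz qq in auto)
  show "alpha1 a u v q 0 = 1" using a1 by (simp add: alpha1_def qpochs_def)
  fix n
  have alpha: "alpha1 a u v q (3 * r) = (1 - a * q ^ (6 * r)) / (1 - a) * poised u v r" for r
    unfolding alpha1_def Let_def div_mod_3 poised_def by simp
  have alpha0: "alpha1 a u v q (3 * r + 1) = 0" "alpha1 a u v q (3 * r + 2) = 0" for r
    unfolding alpha1_def Let_def div_mod_3 by simp_all
  have "(if 3 * r \<le> n then alpha1 a u v q (3 * r) / (qpoch q q (n - 3 * r) * qpoch (a * q) q (n + 3 * r)) else 0)
      = (1 - a * q ^ (6 * r)) * poised u v r * ker (int n) r" for r
  proof (cases "3 * r \<le> n")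
    case True
    then obtain k where n: "n = k + 3 * r" by (metis le_add_diff_inverse2)
    \<comment> \<open>The denominator \<open>1 - a\<close> of \<alpha> extends the product starting
      at \<open>a q\<close> to one starting at \<open>a\<close>.\<close>
    have "ker (int n) r = 1 / (qpoch q q k * ((1 - a) * qpoch (a * q) q (k + 6 * r)))"
      unfolding n ker_nat by (simp add: qpoch_Suc_shift)
    moreover have "n - 3 * r = k" "n + 3 * r = k + 6 * r" using n by simp_all
    ultimately show ?thesis using True a1 unfolding alpha by (simp only: if_True) simp
  qed (simp add: ker_eq_0)
  then have "(\<Sum>j\<le>n. alpha1 a u v q j / (qpoch q q (n - j) * qpoch (a * q) q (n + j)))
      = (\<Sum>r\<le>n. (1 - a * q ^ (6 * r)) * poised u v r * ker (int n) r)"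
    by (subst sum_by_residue_3) (simp only: sum_lessThan_3 alpha0 add_0_right div_0 if_cancel)
  also have "\<dots> = beta1 a u v q n"
    unfolding beta1_def by (rule poised_sum[OF nz(2,3) den Kden])
  finally show "(\<Sum>j\<le>n. alpha1 a u v q j / (qpoch q q (n - j) * qpoch (a * q) q (n + j))) = beta1 a u v q n" .
qed

lemma generic2D:
  assumes "generic2 a u v q"
  shows "cubic_bailey (a * q) q" "q \<noteq> 0" "u \<noteq> 0" "v \<noteq> 0"
    and "\<And>r. qpochs [u, v, a * q / u, a * q / v, q ^ 3] (q ^ 3) r \<noteq> 0"
    and "\<And>n. K_den (a * q) (q powi (- int n)) (q powi (1 - int n)) (q powi (2 - int n)) (a * q) u v (q ^ 3) \<noteq> 0"
  using assms by (auto simp: generic2_def generic_common_def cubic_bailey_def)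

text \<open>The power \<open>(- (a * q)) ^ r\<close> contributes \<open>q^r\<close>, the difference
  of the two exponents.\<close>

lemma A_coeff_poised:
  assumes "cubic_bailey (a * q) q"
  shows "A_coeff a u v q r * q powi ((9 * (int r)\<^sup>2 - 13 * int r) div 2) * (- a) ^ r
       = cubic_bailey.poised (a * q) q u v r"
proof -
  interpret cubic_bailey "a * q" q by (rule assms)
  have "(9 * (int r)\<^sup>2 - 13 * int r) = (9 * (int r)\<^sup>2 - 15 * int r) + int r * 2" by simp
  then have "(9 * (int r)\<^sup>2 - 13 * int r) div 2 = (9 * (int r)\<^sup>2 - 15 * int r) div 2 + int r"
    by (metis div_mult_self1 add.commute zero_neq_numeral)
  then have "q powi ((9 * (int r)\<^sup>2 - 13 * int r) div 2) = q powi ((9 * (int r)\<^sup>2 - 15 * int r) div 2) * q ^ r"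
    using q_nz by (simp only: power_int_add power_int_of_nat simp_thms)
  moreover have "(- (a * q)) ^ r = (- a) ^ r * q ^ r"
    by (simp flip: power_mult_distrib)
  moreover have "a * q * q ^ 3 = a * q ^ 4" by (simp add: eval_nat_numeral)
  ultimately show ?thesis by (simp only: A_coeff_def poised_def mult_ac)
qed

lemma bailey_pair_2:
  assumes "generic2 a u v q"
  shows "beta2 a u v q 0 = 1 \<and> bailey_pair a q (alpha2 a u v q) (beta2 a u v q)"
proof (rule bailey_pairI)
  note gen = generic2D[OF assms]
  interpret cubic_bailey "a * q" q by (rule gen)
  define S where "S r = A_coeff a u v q r * q powi ((9 * (int r)\<^sup>2 - 13 * int r) div 2) * (- a) ^ r" for r
  have S: "S r = poised u v r" for r unfolding S_def by (rule A_coeff_poised[OF gen(1)])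
  define t where "t r = A_coeff a u v q r * q powi ((9 * (int r)\<^sup>2 - int r) div 2 + 1) * (- a) ^ (r + 1)" for r
  have t: "t r = - a * q * q ^ (6 * r) * S r" for r
  proof -
    have "(9 * (int r)\<^sup>2 - int r) = (9 * (int r)\<^sup>2 - 13 * int r) + int (6 * r) * 2" by simp
    then have "(9 * (int r)\<^sup>2 - int r) div 2 = (9 * (int r)\<^sup>2 - 13 * int r) div 2 + int (6 * r)"
      by (metis div_mult_self1 add.commute zero_neq_numeral)
    then have "q powi ((9 * (int r)\<^sup>2 - int r) div 2 + 1) = q powi ((9 * (int r)\<^sup>2 - 13 * int r) div 2) * q ^ (6 * r) * q"
      using q_nz by (simp only: power_int_add power_int_of_nat power_int_1_right simp_thms)
    then show ?thesis unfolding t_def S_def by simp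
  qed
  show "alpha2 a u v q 0 = 1" by (simp add: alpha2_def A_coeff_def qpochs_def)
  fix n
  \<comment> \<open>By \<open>t\<close>, the two contributions \<open>a q^(n + 3r + 1)\<close>
    cancel and the very-well-poised factor for \<open>a q\<close> remains.\<close>
  have "S r * (1 - a * q * q ^ (n + 3 * r)) + t r * (1 - q ^ (n - 3 * r))
      = (1 - a * q * q ^ (6 * r)) * S r" if "3 * r \<le> n" for r
  proof -
    have "q ^ (n + 3 * r) = q ^ (6 * r) * q ^ (n - 3 * r)" using that by (simp add: add.commute flip: power_add)
    then show ?thesis unfolding t by (simp add: algebra_simps)
  qed
  then have "(\<Sum>r\<le>n. (S r * (1 - a * q * q ^ (n + 3 * r)) + t r * (1 - q ^ (n - 3 * r))) * ker (int n) r)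
      = (\<Sum>r\<le>n. (1 - a * q * q ^ (6 * r)) * S r * ker (int n) r)"
    by (rule sum_ker_cong)
  also have "\<dots> = beta2 a u v q n"
    unfolding beta2_def S poised_sum[OF gen(3-6)] by (simp add: K0_def K0'_def)
  finally have sum: "(\<Sum>r\<le>n. (S r * (1 - a * q * q ^ (n + 3 * r)) + t r * (1 - q ^ (n - 3 * r))) * ker (int n) r) = beta2 a u v q n" .
  have c: "alpha2 a u v q (3 * r) = S r" "alpha2 a u v q (3 * r + 1) = t r" "alpha2 a u v q (3 * r + 2) = 0" for r
    unfolding alpha2_def Let_def div_mod_3 S_def t_def by simp_all
  show "(\<Sum>j\<le>n. alpha2 a u v q j / (qpoch q q (n - j) * qpoch (a * q) q (n + j))) = beta2 a u v q n"
    unfolding adjacent_sum[OF c] by (rule sum)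
qed

lemma bailey_pair_3:
  assumes "generic2 a u v q"
  shows "beta3 a u v q 0 = 1 \<and> bailey_pair a q (alpha3 a u v q) (beta3 a u v q)"
proof (rule bailey_pairI)
  note gen = generic2D[OF assms]
  interpret cubic_bailey "a * q" q by (rule gen)
  define S where "S r = A_coeff a u v q r * q powi ((9 * (int r)\<^sup>2 - 7 * int r) div 2) * (- a) ^ r" for r
  have S: "S r = q ^ (3 * r) * poised u v r" for r
  proof -
    have "(9 * (int r)\<^sup>2 - 7 * int r) = (9 * (int r)\<^sup>2 - 13 * int r) + int (3 * r) * 2" by simp
    then have "(9 * (int r)\<^sup>2 - 7 * int r) div 2 = (9 * (int r)\<^sup>2 - 13 * int r) div 2 + int (3 * r)"
      by (metis div_mult_self1 add.commute zero_neq_numeral)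
    then have "q powi ((9 * (int r)\<^sup>2 - 7 * int r) div 2) = q powi ((9 * (int r)\<^sup>2 - 13 * int r) div 2) * q ^ (3 * r)"
      using q_nz by (simp only: power_int_add power_int_of_nat simp_thms)
    then show ?thesis unfolding S_def A_coeff_poised[OF gen(1), symmetric] by simp
  qed
  show "alpha3 a u v q 0 = 1" by (simp add: alpha3_def A_coeff_def qpochs_def)
  fix n
  \<comment> \<open>The constants cancel and \<open>q^(n - 3r)\<close> factors out; with the
    \<open>q^(3r)\<close> in \<open>S\<close> it forms the extra \<open>q^n\<close> of
    \<beta>.\<close>
  have "S r * (1 - a * q * q ^ (n + 3 * r)) + - S r * (1 - q ^ (n - 3 * r))
      = q ^ n * ((1 - a * q * q ^ (6 * r)) * poised u v r)" if "3 * r \<le> n" for r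
  proof -
    have "q ^ (n + 3 * r) = q ^ (6 * r) * q ^ (n - 3 * r)" "q ^ n = q ^ (3 * r) * q ^ (n - 3 * r)"
      using that by (simp_all add: add.commute flip: power_add)
    then show ?thesis unfolding S by (simp add: algebra_simps)
  qed
  then have "(\<Sum>r\<le>n. (S r * (1 - a * q * q ^ (n + 3 * r)) + - S r * (1 - q ^ (n - 3 * r))) * ker (int n) r)
      = (\<Sum>r\<le>n. q ^ n * ((1 - a * q * q ^ (6 * r)) * poised u v r) * ker (int n) r)"
    by (rule sum_ker_cong)
  also have "\<dots> = q ^ n * (\<Sum>r\<le>n. (1 - a * q * q ^ (6 * r)) * poised u v r * ker (int n) r)"
    by (simp only: sum_distrib_left mult.assoc)
  also have "\<dots> = beta3 a u v q n"
    unfolding beta3_def poised_sum[OF gen(3-6)] by (simp add: K0_def K0'_def)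
  finally have sum: "(\<Sum>r\<le>n. (S r * (1 - a * q * q ^ (n + 3 * r)) + - S r * (1 - q ^ (n - 3 * r))) * ker (int n) r) = beta3 a u v q n" .
  have c: "alpha3 a u v q (3 * r) = S r" "alpha3 a u v q (3 * r + 1) = - S r" "alpha3 a u v q (3 * r + 2) = 0" for r
    unfolding alpha3_def Let_def div_mod_3 S_def by simp_all
  show "(\<Sum>j\<le>n. alpha3 a u v q j / (qpoch q q (n - j) * qpoch (a * q) q (n + j))) = beta3 a u v q n"
    unfolding adjacent_sum[OF c] by (rule sum)
qed

theorem theorem2p3:
  fixes a u v q :: complex
  shows "(generic1 a u v q \<longrightarrow>
            beta1 a u v q 0 = 1 \<and> bailey_pair a q (alpha1 a u v q) (beta1 a u v q)) \<and>
         (generic2 a u v q \<longrightarrow>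
            beta2 a u v q 0 = 1 \<and> bailey_pair a q (alpha2 a u v q) (beta2 a u v q)) \<and>
         (generic2 a u v q \<longrightarrow>
            beta3 a u v q 0 = 1 \<and> bailey_pair a q (alpha3 a u v q) (beta3 a u v q))"
  using bailey_pair_1 bailey_pair_2 bailey_pair_3 by blast

end
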